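(* When $\mathcal S$ is a class of monomorphisms, $(s,f)\sim_{\mathrm a}(t,g)$ just means that the two $\mathcal S$-spans are isomorphic. In other words, if $\mathcal S$ contains only monomorphisms of $\mathcal C$, then $\mathsf{Sect}(\mathcal C,\mathcal S)\cong\mathsf{Span}(\mathcal C,\mathcal S)$ is (isomorphic to) the $\mathcal S$-partial map category of $\mathcal C$.
   Context: Standing assumptions: $\mathcal C$ is a category and $\mathcal S$ is a class of morphisms of $\mathcal C$ that contains all isomorphisms, is closed under composition, and is such that pullbacks of $\mathcal S$-morphisms along arbitrary morphisms exist in $\mathcal C$ and belong to $\mathcal S$. $\mathcal S$-spans: an $\mathcal S$-span $(s,f):A\to B$ is a pair $s:D\to A$ in $\mathcal S$, $f:D\to B$ in $\mathcal C$. A (vertical) morphism $x:(s,f)\to(\tilde s,\tilde f)$ is a $\mathcal C$-morphism with $\tilde s\cdot x=s$, $\tilde f\cdot x=f$. $\mathsf{Span}(\mathcal C,\mathcal S)$ is the category with the objects of $\mathcal C$ and isomorphism classes of $\mathcal S$-spans as morphisms, with (horizontal) composition $(t,g)\cdot(s,f)=(s\cdot t',g\cdot f')$, where $f\cdot t'=t\cdot f'$ is a pullback square. When $\mathcal S$ is a class of monomorphisms, $\mathsf{Span}(\mathcal C,\mathcal S)$ is the category known as the $\mathcal S$-partial map category of $\mathcal C$. A relation for $\mathcal S$-spans is compatible if it relates only $\mathcal S$-spans with the same domain and codomain, relates vertically isomorphic $\mathcal S$-spans, and is preserved by horizontal composition from either side. An $\mathcal S$-cospan $\langle f,s\rangle:A\to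 B$ is (the isomorphism class of) a pair $f:A\to D$ in $\mathcal C$, $s:B\to D$ in $\mathcal S$; write $\langle f,s\rangle\preceq\langle g,t\rangle$ iff there is $v\in\mathcal S$ with $v\cdot f=g$, $v\cdot s=t$. $\mathrm{pb}\langle f,s\rangle:=(s',f')$ is the $\mathcal S$-span given by the pullback square $f\cdot s'=s\cdot f'$. $\approx_{\mathrm a}$ is the least compatible relation for $\mathcal S$-spans such that $\langle f,s\rangle\preceq\langle g,t\rangle$ implies $\mathrm{pb}\langle f,s\rangle\approx_{\mathrm a}\mathrm{pb}\langle g,t\rangle$; $\sim_{\mathrm a}$ is the equivalence relation generated by it (it is compatible), and $\mathsf{Sect}(\mathcal C,\mathcal S)$ is the quotient category of $\mathsf{Span}(\mathcal C,\mathcal S)$ by $\sim_{\mathrm a}$. *)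

theory Defs
  imports Main
begin

section \<open>Categories and functors\<close>

record ('o, 'a) cat =
  Obj :: "'o set"
  Arr :: "'a set"
  Dom :: "'a \<Rightarrow> 'o"
  Cod :: "'a \<Rightarrow> 'o"
  Ide :: "'o \<Rightarrow> 'a"
  Cmp :: "'a \<Rightarrow> 'a \<Rightarrow> 'a"  (infixr "\<cdot>\<index>" 70)

definition homset :: "('o, 'a) cat \<Rightarrow> 'o \<Rightarrow> 'o \<Rightarrow> 'a set" where
  "homset C A B = {f \<in> Arr C. Dom C f = A \<and> Cod C f = B}"

text \<open>The composite \<open>g \<cdot> f\<close> is meaningful only if \<open>Cod f = Dom g\<close>; on other
  arguments \<open>Cmp\<close> is unspecified.\<close>

locale category =
  fixes C :: "('o, 'a) cat" (structure)
  assumes Dom_Obj: "f \<in> Arr C \<Longrightarrow> Dom C f \<in> Obj C"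
    and Cod_Obj: "f \<in> Arr C \<Longrightarrow> Cod C f \<in> Obj C"
    and Ide_homset: "A \<in> Obj C \<Longrightarrow> Ide C A \<in> homset C A A"
    and Cmp_homset: "f \<in> homset C A B \<Longrightarrow> g \<in> homset C B D \<Longrightarrow> g \<cdot> f \<in> homset C A D"
    and Cmp_Ide: "f \<in> homset C A B \<Longrightarrow> f \<cdot> Ide C A = f"
    and Ide_Cmp: "f \<in> homset C A B \<Longrightarrow> Ide C B \<cdot> f = f"
    and Cmp_assoc: "f \<in> homset C A B \<Longrightarrow> g \<in> homset C B D \<Longrightarrow> h \<in> homset C D E
      \<Longrightarrow> (h \<cdot> g) \<cdot> f = h \<cdot> (g \<cdot> f)"

definition is_mono :: "('o, 'a) cat \<Rightarrow> 'a \<Rightarrow> bool" where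
  "is_mono C m \<longleftrightarrow> m \<in> Arr C \<and>
     (\<forall>X. \<forall>a \<in> homset C X (Dom C m). \<forall>b \<in> homset C X (Dom C m).
        m \<cdot>\<^bsub>C\<^esub> a = m \<cdot>\<^bsub>C\<^esub> b \<longrightarrow> a = b)"

definition is_iso :: "('o, 'a) cat \<Rightarrow> 'a \<Rightarrow> bool" where
  "is_iso C x \<longleftrightarrow> x \<in> Arr C \<and>
     (\<exists>y \<in> homset C (Cod C x) (Dom C x).
        y \<cdot>\<^bsub>C\<^esub> x = Ide C (Dom C x) \<and> x \<cdot>\<^bsub>C\<^esub> y = Ide C (Cod C x))"

text \<open>\<open>is_pullback C f t t' f'\<close>: the square \<open>f \<cdot> t' = t \<cdot> f'\<close> is a pullback, so \<open>t'\<close> is a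
  pullback of \<open>t\<close> along \<open>f\<close>.\<close>

definition is_pullback :: "('o, 'a) cat \<Rightarrow> 'a \<Rightarrow> 'a \<Rightarrow> 'a \<Rightarrow> 'a \<Rightarrow> bool" where
  "is_pullback C f t t' f' \<longleftrightarrow>
     f \<in> Arr C \<and> t \<in> Arr C \<and> Cod C f = Cod C t \<and>
     t' \<in> homset C (Dom C t') (Dom C f) \<and> f' \<in> homset C (Dom C t') (Dom C t) \<and>
     f \<cdot>\<^bsub>C\<^esub> t' = t \<cdot>\<^bsub>C\<^esub> f' \<and>
     (\<forall>X. \<forall>a \<in> homset C X (Dom C f). \<forall>b \<in> homset C X (Dom C t).
        f \<cdot>\<^bsub>C\<^esub> a = t \<cdot>\<^bsub>C\<^esub> b \<longrightarrow>
        (\<exists>!u. u \<in> homset C X (Dom C t') \<and> t' \<cdot>\<^bsub>C\<^esub> u = a \<and> f' \<cdot>\<^bsub>C\<^esub> u = b))"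

locale cat_functor = dom: category C + cod: category D
  for C :: "('o, 'a) cat" and D :: "('p, 'b) cat" +
  fixes Fo :: "'o \<Rightarrow> 'p" and Fa :: "'a \<Rightarrow> 'b"
  assumes Fo_Obj: "A \<in> Obj C \<Longrightarrow> Fo A \<in> Obj D"
    and Fa_homset: "f \<in> homset C A B \<Longrightarrow> Fa f \<in> homset D (Fo A) (Fo B)"
    and Fa_Ide: "A \<in> Obj C \<Longrightarrow> Fa (Ide C A) = Ide D (Fo A)"
    and Fa_Cmp: "f \<in> homset C A B \<Longrightarrow> g \<in> homset C B E \<Longrightarrow> Fa (g \<cdot>\<^bsub>C\<^esub> f) = Fa g \<cdot>\<^bsub>D\<^esub> Fa f"

definition iso_functor ::
  "('o, 'a) cat \<Rightarrow> ('p, 'b) cat \<Rightarrow> ('o \<Rightarrow> 'p) \<Rightarrow> ('a \<Rightarrow> 'b) \<Rightarrow> bool" where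
  "iso_functor C D Fo Fa \<longleftrightarrow> cat_functor C D Fo Fa \<and>
     (\<exists>Go Ga. cat_functor D C Go Ga \<and>
        (\<forall>A \<in> Obj C. Go (Fo A) = A) \<and> (\<forall>f \<in> Arr C. Ga (Fa f) = f) \<and>
        (\<forall>B \<in> Obj D. Fo (Go B) = B) \<and> (\<forall>g \<in> Arr D. Fa (Ga g) = g))"

definition isomorphic_cats :: "('o, 'a) cat \<Rightarrow> ('p, 'b) cat \<Rightarrow> bool" where
  "isomorphic_cats C D \<longleftrightarrow> (\<exists>Fo Fa. iso_functor C D Fo Fa)"

text \<open>The quotient of a category by a congruence \<open>R\<close>, that is, an equivalence relation on
  \<open>Arr C\<close> that relates only parallel arrows and is preserved by composition. On objects the
  quotient functor is the identity, on arrows it sends \<open>f\<close> to \<open>R `` {f}\<close>. The arguments of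
  \<open>the_elem\<close> are then singletons, and all sets in the union of a composite coincide.\<close>

definition quotient_cat :: "('o, 'a) cat \<Rightarrow> ('a \<times> 'a) set \<Rightarrow> ('o, 'a set) cat" where
  "quotient_cat C R =
     \<lparr> Obj = Obj C,
       Arr = Arr C // R,
       Dom = (\<lambda>X. the_elem (Dom C ` X)),
       Cod = (\<lambda>X. the_elem (Cod C ` X)),
       Ide = (\<lambda>A. R `` {Ide C A}),
       Cmp = (\<lambda>Y X. \<Union>g \<in> Y. \<Union>f \<in> X. R `` {g \<cdot>\<^bsub>C\<^esub> f}) \<rparr>"


section \<open>Spans of a stable class\<close>

locale stable_class = category C
  for C :: "('o, 'a) cat" (structure) +
  fixes S :: "'a set"
  assumes S_Arr: "S \<subseteq> Arr C"
    and iso_in_S: "is_iso C x \<Longrightarrow> x \<in> S"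
    and S_Cmp: "s \<in> S \<Longrightarrow> t \<in> S \<Longrightarrow> Cod C s = Dom C t \<Longrightarrow> t \<cdot> s \<in> S"
    and pullback_exists: "f \<in> Arr C \<Longrightarrow> s \<in> S \<Longrightarrow> Cod C f = Cod C s
      \<Longrightarrow> \<exists>s' f'. is_pullback C f s s' f'"
    and pullback_in_S: "s \<in> S \<Longrightarrow> is_pullback C f s s' f' \<Longrightarrow> s' \<in> S"

definition spans :: "('o, 'a) cat \<Rightarrow> 'a set \<Rightarrow> ('a \<times> 'a) set" where
  "spans C S = {(s, f). s \<in> S \<and> s \<in> Arr C \<and> f \<in> Arr C \<and> Dom C s = Dom C f}"

text \<open>The span \<open>(s, f)\<close> with \<open>s : D \<rightarrow> A\<close> and \<open>f : D \<rightarrow> B\<close> goes from \<open>A\<close> to \<open>B\<close>.\<close>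

definition span_dom :: "('o, 'a) cat \<Rightarrow> 'a \<times> 'a \<Rightarrow> 'o" where
  "span_dom C p = Cod C (fst p)"

definition span_cod :: "('o, 'a) cat \<Rightarrow> 'a \<times> 'a \<Rightarrow> 'o" where
  "span_cod C p = Cod C (snd p)"

definition vertical :: "('o, 'a) cat \<Rightarrow> 'a \<Rightarrow> 'a \<times> 'a \<Rightarrow> 'a \<times> 'a \<Rightarrow> bool" where
  "vertical C x p q \<longleftrightarrow> x \<in> homset C (Dom C (fst p)) (Dom C (fst q)) \<and>
     fst q \<cdot>\<^bsub>C\<^esub> x = fst p \<and> snd q \<cdot>\<^bsub>C\<^esub> x = snd p"

definition span_iso :: "('o, 'a) cat \<Rightarrow> 'a set \<Rightarrow> (('a \<times> 'a) \<times> ('a \<times> 'a)) set" where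
  "span_iso C S = {(p, q). p \<in> spans C S \<and> q \<in> spans C S \<and>
     (\<exists>x y. vertical C x p q \<and> vertical C y q p \<and>
        y \<cdot>\<^bsub>C\<^esub> x = Ide C (Dom C (fst p)) \<and> x \<cdot>\<^bsub>C\<^esub> y = Ide C (Dom C (fst q)))}"

text \<open>\<open>span_comp C S q p h\<close>: the span \<open>h\<close> is a horizontal composite of \<open>p\<close> followed by \<open>q\<close>,
  formed with some choice of the pullback.\<close>

definition span_comp ::
  "('o, 'a) cat \<Rightarrow> 'a set \<Rightarrow> 'a \<times> 'a \<Rightarrow> 'a \<times> 'a \<Rightarrow> 'a \<times> 'a \<Rightarrow> bool" where
  "span_comp C S q p h \<longleftrightarrow> p \<in> spans C S \<and> q \<in> spans C S \<and>
     (case p of (s, f) \<Rightarrow> case q of (t, g) \<Rightarrow>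
        \<exists>t' f'. is_pullback C f t t' f' \<and> h = (s \<cdot>\<^bsub>C\<^esub> t', g \<cdot>\<^bsub>C\<^esub> f'))"

definition Span :: "('o, 'a) cat \<Rightarrow> 'a set \<Rightarrow> ('o, ('a \<times> 'a) set) cat" where
  "Span C S =
     \<lparr> Obj = Obj C,
       Arr = spans C S // span_iso C S,
       Dom = (\<lambda>X. the_elem (span_dom C ` X)),
       Cod = (\<lambda>X. the_elem (span_cod C ` X)),
       Ide = (\<lambda>A. span_iso C S `` {(Ide C A, Ide C A)}),
       Cmp = (\<lambda>Y X. \<Union>q \<in> Y. \<Union>p \<in> X. span_iso C S `` {h. span_comp C S q p h}) \<rparr>"

text \<open>For a class \<open>S\<close> of monomorphisms, \<open>S\<close>-partial maps are isomorphism classes of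
  \<open>S\<close>-spans, composed by pullback.\<close>

abbreviation (input) partial_map_cat :: "('o, 'a) cat \<Rightarrow> 'a set \<Rightarrow> ('o, ('a \<times> 'a) set) cat" where
  "partial_map_cat C S \<equiv> Span C S"

text \<open>Composites are determined only up to vertical isomorphism; preservation is required for
  all choices of pullbacks.\<close>

definition compatible ::
  "('o, 'a) cat \<Rightarrow> 'a set \<Rightarrow> (('a \<times> 'a) \<times> ('a \<times> 'a)) set \<Rightarrow> bool" where
  "compatible C S R \<longleftrightarrow>
     (\<forall>(p, q) \<in> R. p \<in> spans C S \<and> q \<in> spans C S \<and>
        span_dom C p = span_dom C q \<and> span_cod C p = span_cod C q) \<and>
     span_iso C S \<subseteq> R \<and>
     (\<forall>(p, q) \<in> R. \<forall>r h k. span_comp C S r p h \<and> span_comp C S r q k \<longrightarrow> (h, k) \<in> R) \<and>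
     (\<forall>(p, q) \<in> R. \<forall>r h k. span_comp C S p r h \<and> span_comp C S q r k \<longrightarrow> (h, k) \<in> R)"


section \<open>Cospans and the quotient\<close>

text \<open>Cospans are represented by pairs rather than by isomorphism classes: the order and
  \<open>is_pb\<close> do not depend on the representatives, as \<open>S\<close> contains all isomorphisms and is
  closed under composition.\<close>

definition cospans :: "('o, 'a) cat \<Rightarrow> 'a set \<Rightarrow> ('a \<times> 'a) set" where
  "cospans C S = {(f, s). f \<in> Arr C \<and> s \<in> S \<and> s \<in> Arr C \<and> Cod C f = Cod C s}"

definition cospan_le :: "('o, 'a) cat \<Rightarrow> 'a set \<Rightarrow> 'a \<times> 'a \<Rightarrow> 'a \<times> 'a \<Rightarrow> bool" where
  "cospan_le C S c d \<longleftrightarrow> c \<in> cospans C S \<and> d \<in> cospans C S \<and>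
     (\<exists>v \<in> S. v \<in> homset C (Cod C (fst c)) (Cod C (fst d)) \<and>
        v \<cdot>\<^bsub>C\<^esub> fst c = fst d \<and> v \<cdot>\<^bsub>C\<^esub> snd c = snd d)"

definition is_pb :: "('o, 'a) cat \<Rightarrow> 'a \<times> 'a \<Rightarrow> 'a \<times> 'a \<Rightarrow> bool" where
  "is_pb C c p \<longleftrightarrow> is_pullback C (fst c) (snd c) (fst p) (snd p)"

definition approx_a :: "('o, 'a) cat \<Rightarrow> 'a set \<Rightarrow> (('a \<times> 'a) \<times> ('a \<times> 'a)) set" where
  "approx_a C S = \<Inter>{R. compatible C S R \<and>
     (\<forall>c d p q. cospan_le C S c d \<and> is_pb C c p \<and> is_pb C d q \<longrightarrow> (p, q) \<in> R)}"

definition sim_a :: "('o, 'a) cat \<Rightarrow> 'a set \<Rightarrow> (('a \<times> 'a) \<times> ('a \<times> 'a)) set" where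
  "sim_a C S = \<Inter>{E. equiv (spans C S) E \<and> approx_a C S \<subseteq> E}"

text \<open>\<open>sim_a\<close> relates spans; this is the relation it induces on the arrows of \<open>Span C S\<close>.\<close>

definition sim_a_class ::
  "('o, 'a) cat \<Rightarrow> 'a set \<Rightarrow> (('a \<times> 'a) set \<times> ('a \<times> 'a) set) set" where
  "sim_a_class C S = {(span_iso C S `` {p}, span_iso C S `` {q}) | p q. (p, q) \<in> sim_a C S}"

definition Sect :: "('o, 'a) cat \<Rightarrow> 'a set \<Rightarrow> ('o, ('a \<times> 'a) set set) cat" where
  "Sect C S = quotient_cat (Span C S) (sim_a_class C S)"

end

theory Submission
  imports Defs
begin

text \<open>If \<open>v\<close> is a monomorphism, a square over \<open>(f, s)\<close> is a pullback iff it is one over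
  \<open>(v \<cdot> f, v \<cdot> s)\<close>, so the generating pairs of the relation \<open>approx_a\<close> are vertically isomorphic
  spans already. As vertical isomorphism is a compatible equivalence relation, it coincides with
  \<open>approx_a\<close> and with \<open>sim_a\<close>, and the induced congruence on \<open>Span C S\<close> is equality.\<close>

text \<open>Collapsing the relations leaves a question of types and representatives. The quotient by
  equality is not \<open>Span C S\<close> itself: its arrows are singletons of span classes, so the
  isomorphism is \<open>X \<mapsto> {X}\<close> with inverse \<open>the_elem\<close>. Moreover,
  \<open>cat_functor\<close> has both categories among its assumptions, so \<open>Span C S\<close>
  must be shown to be a category. No pullbacks are chosen there: a composite is a union over all
  representatives and all pullback squares. The crux is that every choice leads to the same class;
  afterwards each category law may be checked with whichever pullback is most convenient.\<close>

context category
begin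

section \<open>Composition in terms of domains and codomains\<close>

lemma Cmp_arr [simp]:
  assumes "f \<in> Arr C" "g \<in> Arr C" "Dom C g = Cod C f"
  shows "g \<cdot> f \<in> Arr C" "Dom C (g \<cdot> f) = Dom C f" "Cod C (g \<cdot> f) = Cod C g"
  using Cmp_homset[of f "Dom C f" "Cod C f" g "Cod C g"] assms by (auto simp: homset_def)

lemma Ide_arr [simp]:
  assumes "A \<in> Obj C"
  shows "Ide C A \<in> Arr C" "Dom C (Ide C A) = A" "Cod C (Ide C A) = A"
  using Ide_homset[OF assms] by (auto simp: homset_def)

text \<open>Side conditions on \<open>Dom\<close> and \<open>Cod\<close> replace hom-sets, whose
  objects the simplifier would have to guess. Not a simp rule, because it is used in both
  directions: forwards to normalise brackets, flipped to bring a known composite together.\<close>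

lemma Cmp_assoc_arr:
  assumes "f \<in> Arr C" "g \<in> Arr C" "h \<in> Arr C" "Dom C g = Cod C f" "Dom C h = Cod C g"
  shows "(h \<cdot> g) \<cdot> f = h \<cdot> (g \<cdot> f)"
  by (rule Cmp_assoc[of f "Dom C f" "Cod C f" g "Cod C g" h "Cod C h"])
    (use assms in \<open>auto simp: homset_def\<close>)

lemma Cmp_Ide_arr [simp]: "f \<in> Arr C \<Longrightarrow> A = Dom C f \<Longrightarrow> f \<cdot> Ide C A = f"
  using Cmp_Ide by (auto simp: homset_def)

lemma Ide_Cmp_arr [simp]: "f \<in> Arr C \<Longrightarrow> A = Cod C f \<Longrightarrow> Ide C A \<cdot> f = f"
  using Ide_Cmp by (auto simp: homset_def)

lemma Ide_is_iso: "A \<in> Obj C \<Longrightarrow> is_iso C (Ide C A)"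
  by (auto simp: is_iso_def homset_def intro!: bexI[of _ "Ide C A"])

section \<open>Monomorphisms and pullback squares\<close>

lemma mono_cancel:
  assumes "is_mono C m" "a \<in> Arr C" "b \<in> Arr C" "Cod C a = Dom C m" "Cod C b = Dom C m"
    "Dom C a = Dom C b" "m \<cdot> a = m \<cdot> b"
  shows "a = b"
  using assms unfolding is_mono_def homset_def by blast

text \<open>Unique factorisation is split into existence of a lift and joint monicity of the legs
  \<open>t'\<close> and \<open>f'\<close>; the second half need not mention the cone being
  factored.\<close>

lemma pullbackI:
  assumes "f \<in> Arr C" "t \<in> Arr C" "t' \<in> Arr C" "f' \<in> Arr C"
    and "Cod C f = Cod C t" "Cod C t' = Dom C f" "Dom C f' = Dom C t'" "Cod C f' = Dom C t"
    and "f \<cdot> t' = t \<cdot> f'"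
    and lift: "\<And>a b. \<lbrakk>a \<in> Arr C; b \<in> Arr C; Dom C a = Dom C b; Cod C a = Dom C f;
        Cod C b = Dom C t; f \<cdot> a = t \<cdot> b\<rbrakk>
      \<Longrightarrow> \<exists>u \<in> Arr C. Dom C u = Dom C b \<and> Cod C u = Dom C t' \<and> t' \<cdot> u = a \<and> f' \<cdot> u = b"
    and uniq: "\<And>u v. \<lbrakk>u \<in> Arr C; v \<in> Arr C; Dom C u = Dom C v; Cod C u = Dom C t';
        Cod C v = Dom C t'; t' \<cdot> u = t' \<cdot> v; f' \<cdot> u = f' \<cdot> v\<rbrakk> \<Longrightarrow> u = v"
  shows "is_pullback C f t t' f'"
proof -
  have "\<exists>!u. u \<in> homset C X (Dom C t') \<and> t' \<cdot> u = a \<and> f' \<cdot> u = b"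
    if "a \<in> homset C X (Dom C f)" "b \<in> homset C X (Dom C t)" "f \<cdot> a = t \<cdot> b" for X a b
  proof (rule ex_ex1I)
    show "\<exists>u. u \<in> homset C X (Dom C t') \<and> t' \<cdot> u = a \<and> f' \<cdot> u = b"
      using lift[of a b] that by (auto simp: homset_def)
    show "u = v" if "u \<in> homset C X (Dom C t') \<and> t' \<cdot> u = a \<and> f' \<cdot> u = b"
      "v \<in> homset C X (Dom C t') \<and> t' \<cdot> v = a \<and> f' \<cdot> v = b" for u v
      using uniq[of u v] that by (auto simp: homset_def)
  qed
  then show ?thesis
    using assms(1-9) unfolding is_pullback_def by (simp add: homset_def)
qed

lemma pullbackD:
  assumes "is_pullback C f t t' f'"
  shows "f \<in> Arr C" "t \<in> Arr C" "t' \<in> Arr C" "f' \<in> Arr C"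
    "Cod C f = Cod C t" "Cod C t' = Dom C f" "Dom C f' = Dom C t'" "Cod C f' = Dom C t"
    "f \<cdot> t' = t \<cdot> f'"
  using assms by (auto simp: is_pullback_def homset_def)

lemma pullback_lift:
  assumes "is_pullback C f t t' f'"
    and "a \<in> Arr C" "b \<in> Arr C" "Dom C a = X" "Dom C b = X" "Cod C a = Dom C f" "Cod C b = Dom C t"
    and "f \<cdot> a = t \<cdot> b"
  obtains u where "u \<in> Arr C" "Dom C u = X" "Cod C u = Dom C t'" "t' \<cdot> u = a" "f' \<cdot> u = b"
proof -
  have "a \<in> homset C X (Dom C f)" "b \<in> homset C X (Dom C t)"
    using assms by (auto simp: homset_def)
  then have "\<exists>!u. u \<in> homset C X (Dom C t') \<and> t' \<cdot> u = a \<and> f' \<cdot> u = b"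
    using assms(1,8) unfolding is_pullback_def by blast
  then show thesis using that by (auto simp: homset_def)
qed

text \<open>Both \<open>u\<close> and \<open>v\<close> factor the cone with legs
  \<open>t' \<cdot> v\<close> and \<open>f' \<cdot> v\<close>.\<close>

lemma pullback_uniq:
  assumes "is_pullback C f t t' f'"
    and uv: "u \<in> Arr C" "v \<in> Arr C" "Dom C u = Dom C v" "Cod C u = Dom C t'" "Cod C v = Dom C t'"
    and eq: "t' \<cdot> u = t' \<cdot> v" "f' \<cdot> u = f' \<cdot> v"
  shows "u = v"
proof -
  note P = pullbackD[OF assms(1)]
  have "t' \<cdot> v \<in> homset C (Dom C v) (Dom C f)" "f' \<cdot> v \<in> homset C (Dom C v) (Dom C t)"
    using P uv by (auto simp: homset_def)
  moreover have "f \<cdot> (t' \<cdot> v) = t \<cdot> (f' \<cdot> v)"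
    using P uv by (simp flip: Cmp_assoc_arr)
  ultimately have
    "\<exists>!w. w \<in> homset C (Dom C v) (Dom C t') \<and> t' \<cdot> w = t' \<cdot> v \<and> f' \<cdot> w = f' \<cdot> v"
    using assms(1) unfolding is_pullback_def by blast
  moreover have "u \<in> homset C (Dom C v) (Dom C t')" "v \<in> homset C (Dom C v) (Dom C t')"
    using uv by (auto simp: homset_def)
  ultimately show ?thesis using eq by blast
qed

text \<open>Makes the one-sided lemmas \<open>pullback_paste\<close>,
  \<open>pullback_iso_leg\<close> and \<open>pullback_Ide\<close> available for the other side of a
  square.\<close>

lemma pullback_sym:
  assumes "is_pullback C f t t' f'"
  shows "is_pullback C t f f' t'"
proof (rule pullbackI)
  note P = pullbackD[OF assms]
  show "\<exists>u\<in>Arr C. Dom C u = Dom C b \<and> Cod C u = Dom C f' \<and> f' \<cdot> u = a \<and> t' \<cdot> u = b"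
    if "a \<in> Arr C" "b \<in> Arr C" "Dom C a = Dom C b" "Cod C a = Dom C t" "Cod C b = Dom C f"
      "t \<cdot> a = f \<cdot> b" for a b
    by (rule pullback_lift[OF assms, of b a "Dom C b"]) (use that P in auto)
  show "u = v"
    if "u \<in> Arr C" "v \<in> Arr C" "Dom C u = Dom C v" "Cod C u = Dom C f'" "Cod C v = Dom C f'"
      "f' \<cdot> u = f' \<cdot> v" "t' \<cdot> u = t' \<cdot> v" for u v
    by (rule pullback_uniq[OF assms]) (use that P in auto)
qed (use pullbackD[OF assms] in auto)

text \<open>The squares share the arrow \<open>f'\<close>. A cone \<open>(a, b)\<close> on the outer
  rectangle gives the cone \<open>(a, w \<cdot> b)\<close> on the first square; its lift
  \<open>u\<close> then forms the cone \<open>(u, b)\<close> on the second.\<close>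

lemma pullback_paste:
  assumes "is_pullback C f t t' f'" "is_pullback C f' w w' g"
  shows "is_pullback C f (t \<cdot> w) (t' \<cdot> w') g"
proof (rule pullbackI)
  note P = pullbackD[OF assms(1)] and Q' = pullbackD[OF assms(2)]
  have tw: "Dom C t = Cod C w" using P(8) Q'(5) by simp
  \<comment> \<open>The omitted fact \<open>Cod C f' = Cod C w\<close> is replaced by
    \<open>tw\<close>, so that \<open>Cod C f'\<close> is rewritten through \<open>Dom C t\<close>
    to \<open>Cod C w\<close>.\<close>
  note Q = Q'(1-4,6-9) tw
  have "f \<cdot> (t' \<cdot> w') = t \<cdot> (f' \<cdot> w')"
    using P Q(1-7,9) by (simp flip: Cmp_assoc_arr)
  also have "\<dots> = (t \<cdot> w) \<cdot> g"
    using P Q by (simp add: Cmp_assoc_arr)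
  finally show "f \<cdot> (t' \<cdot> w') = (t \<cdot> w) \<cdot> g" .
  show "\<exists>u\<in>Arr C. Dom C u = Dom C b \<and> Cod C u = Dom C (t' \<cdot> w') \<and> (t' \<cdot> w') \<cdot> u = a \<and> g \<cdot> u = b"
    if ab: "a \<in> Arr C" "b \<in> Arr C" "Dom C a = Dom C b" "Cod C a = Dom C f"
      "Cod C b = Dom C (t \<cdot> w)" "f \<cdot> a = (t \<cdot> w) \<cdot> b" for a b
  proof -
    have [simp]: "Cod C b = Dom C w" using ab P Q by simp
    obtain u where u: "u \<in> Arr C" "Dom C u = Dom C b" "Cod C u = Dom C t'" "t' \<cdot> u = a"
      "f' \<cdot> u = w \<cdot> b"
      by (rule pullback_lift[OF assms(1), of a "w \<cdot> b" "Dom C b"])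
        (use ab P Q in \<open>auto simp: Cmp_assoc_arr\<close>)
    obtain v where v: "v \<in> Arr C" "Dom C v = Dom C b" "Cod C v = Dom C w'" "w' \<cdot> v = u" "g \<cdot> v = b"
      by (rule pullback_lift[OF assms(2), of u b "Dom C b"]) (use u ab P Q in auto)
    then have "(t' \<cdot> w') \<cdot> v = a" using u P Q by (simp add: Cmp_assoc_arr)
    then show ?thesis using v P Q by auto
  qed
  show "u = v"
    if uv: "u \<in> Arr C" "v \<in> Arr C" "Dom C u = Dom C v" "Cod C u = Dom C (t' \<cdot> w')"
      "Cod C v = Dom C (t' \<cdot> w')" "(t' \<cdot> w') \<cdot> u = (t' \<cdot> w') \<cdot> v" "g \<cdot> u = g \<cdot> v" for u v
  proof -
    have [simp]: "Cod C u = Dom C w'" "Cod C v = Dom C w'" using uv P Q by auto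
    \<comment> \<open>Agreement after \<open>g\<close> thus yields agreement of
      \<open>w' \<cdot> u\<close> and \<open>w' \<cdot> v\<close> after \<open>f'\<close>, the
      second leg of the first square.\<close>
    have *: "f' \<cdot> (w' \<cdot> z) = w \<cdot> (g \<cdot> z)" if "z \<in> Arr C" "Cod C z = Dom C w'" for z
      using that P Q by (simp flip: Cmp_assoc_arr)
    have "w' \<cdot> u = w' \<cdot> v"
      by (rule pullback_uniq[OF assms(1)]) (use uv P Q in \<open>auto simp: Cmp_assoc_arr *\<close>)
    with uv show "u = v"
      by (auto intro: pullback_uniq[OF assms(2), of u v])
  qed
  show "t \<cdot> w \<in> Arr C" "t' \<cdot> w' \<in> Arr C" "Cod C f = Cod C (t \<cdot> w)"
    "Cod C (t' \<cdot> w') = Dom C f" "Dom C g = Dom C (t' \<cdot> w')" "Cod C g = Dom C (t \<cdot> w)"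
    using P Q by auto
qed (use pullbackD[OF assms(1)] pullbackD[OF assms(2)] in auto)

text \<open>The inverse \<open>y\<close> turns a cone \<open>(a, b)\<close> on \<open>f\<close> and
  \<open>t\<close> into the cone \<open>(y \<cdot> a, b)\<close> on \<open>f \<cdot> x\<close> and
  \<open>t\<close>, and \<open>x\<close> carries the lift back. This is how a span inside a
  horizontal composite gets exchanged for an isomorphic one.\<close>

lemma pullback_iso_leg:
  assumes pb: "is_pullback C (f \<cdot> x) t t' f'"
    and f: "f \<in> Arr C" and x: "x \<in> Arr C" "Cod C x = Dom C f"
    and y: "y \<in> Arr C" "Dom C y = Cod C x" "Cod C y = Dom C x"
    and inv: "y \<cdot> x = Ide C (Dom C x)" "x \<cdot> y = Ide C (Cod C x)"
  shows "is_pullback C f t (x \<cdot> t') f'"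
proof (rule pullbackI)
  note P = pullbackD[OF pb]
  have xy: "x \<cdot> (y \<cdot> z) = z" if "z \<in> Arr C" "Cod C z = Dom C f" for z
    using that f x y inv by (simp flip: Cmp_assoc_arr)
  have yx: "y \<cdot> (x \<cdot> z) = z" if "z \<in> Arr C" "Cod C z = Dom C x" for z
    using that f x y inv by (simp flip: Cmp_assoc_arr)
  have [simp]: "Cod C t' = Dom C x" using P f x by simp
  show "f \<cdot> (x \<cdot> t') = t \<cdot> f'"
    using P f x by (simp flip: Cmp_assoc_arr)
  show "\<exists>u\<in>Arr C. Dom C u = Dom C b \<and> Cod C u = Dom C (x \<cdot> t') \<and> (x \<cdot> t') \<cdot> u = a \<and> f' \<cdot> u = b"
    if ab: "a \<in> Arr C" "b \<in> Arr C" "Dom C a = Dom C b" "Cod C a = Dom C f"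
      "Cod C b = Dom C t" "f \<cdot> a = t \<cdot> b" for a b
  proof -
    obtain u where u: "u \<in> Arr C" "Dom C u = Dom C b" "Cod C u = Dom C t'" "t' \<cdot> u = y \<cdot> a"
      "f' \<cdot> u = b"
      by (rule pullback_lift[OF pb, of "y \<cdot> a" b "Dom C b"])
        (use ab f x y in \<open>auto simp: Cmp_assoc_arr xy\<close>)
    then have "(x \<cdot> t') \<cdot> u = a" using P ab f x y by (simp add: Cmp_assoc_arr xy)
    then show ?thesis using u P x by auto
  qed
  show "u = v"
    if uv: "u \<in> Arr C" "v \<in> Arr C" "Dom C u = Dom C v" "Cod C u = Dom C (x \<cdot> t')"
      "Cod C v = Dom C (x \<cdot> t')" "(x \<cdot> t') \<cdot> u = (x \<cdot> t') \<cdot> v" "f' \<cdot> u = f' \<cdot> v" for u v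
  proof (rule pullback_uniq[OF pb])
    have [simp]: "Cod C u = Dom C t'" "Cod C v = Dom C t'" using uv P x by auto
    have "x \<cdot> (t' \<cdot> u) = x \<cdot> (t' \<cdot> v)"
      using uv(6) uv(1,2) P(3) x by (simp add: Cmp_assoc_arr)
    then have "y \<cdot> (x \<cdot> (t' \<cdot> u)) = y \<cdot> (x \<cdot> (t' \<cdot> v))" by simp
    then show "t' \<cdot> u = t' \<cdot> v" using uv(1,2) P(3) by (simp add: yx)
  qed (use uv P x in auto)
qed (use pullbackD[OF pb] f x in auto)

text \<open>Cancelling \<open>v\<close> turns
  \<open>(v \<cdot> f) \<cdot> a = (v \<cdot> s) \<cdot> b\<close> into
  \<open>f \<cdot> a = s \<cdot> b\<close>, so the longer cospan admits no new cones. The legs are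
  the same, hence so is the uniqueness of lifts. This direction suffices, because any two pullbacks
  of the longer cospan are isomorphic.\<close>

lemma pullback_mono:
  assumes pb: "is_pullback C f s s' f'"
    and v: "is_mono C v" "v \<in> Arr C" "Dom C v = Cod C f"
  shows "is_pullback C (v \<cdot> f) (v \<cdot> s) s' f'"
proof (rule pullbackI)
  note P = pullbackD[OF pb]
  show "(v \<cdot> f) \<cdot> s' = (v \<cdot> s) \<cdot> f'"
    using P v by (simp add: Cmp_assoc_arr)
  show "\<exists>u\<in>Arr C. Dom C u = Dom C b \<and> Cod C u = Dom C s' \<and> s' \<cdot> u = a \<and> f' \<cdot> u = b"
    if ab: "a \<in> Arr C" "b \<in> Arr C" "Dom C a = Dom C b" "Cod C a = Dom C (v \<cdot> f)"
      "Cod C b = Dom C (v \<cdot> s)" "(v \<cdot> f) \<cdot> a = (v \<cdot> s) \<cdot> b" for a b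
  proof -
    have cod: "Cod C a = Dom C f" "Cod C b = Dom C s" using ab P v by auto
    have "f \<cdot> a = s \<cdot> b"
      by (rule mono_cancel[OF v(1)]) (use ab cod P v in \<open>auto simp: Cmp_assoc_arr\<close>)
    then show ?thesis
      by (rule pullback_lift[OF pb ab(1-3) refl cod]) auto
  qed
  show "u = w"
    if "u \<in> Arr C" "w \<in> Arr C" "Dom C u = Dom C w" "Cod C u = Dom C s'" "Cod C w = Dom C s'"
      "s' \<cdot> u = s' \<cdot> w" "f' \<cdot> u = f' \<cdot> w" for u w
    by (rule pullback_uniq[OF pb that])
qed (use pullbackD[OF pb] v in auto)

lemma pullback_Ide:
  assumes "f \<in> Arr C"
  shows "is_pullback C f (Ide C (Cod C f)) (Ide C (Dom C f)) f"
  by (rule pullbackI) (use assms Dom_Obj Cod_Obj in auto)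

text \<open>The equations are those needed to read \<open>x\<close> and \<open>y\<close> as mutually
  inverse vertical morphisms between the spans \<open>(t1, f1)\<close> and
  \<open>(t2, f2)\<close>.\<close>

lemma pullback_iso:
  assumes "is_pullback C f t t1 f1" "is_pullback C f t t2 f2"
  obtains x y where "x \<in> Arr C" "Dom C x = Dom C t1" "Cod C x = Dom C t2"
    "y \<in> Arr C" "Dom C y = Dom C t2" "Cod C y = Dom C t1"
    "t2 \<cdot> x = t1" "f2 \<cdot> x = f1" "t1 \<cdot> y = t2" "f1 \<cdot> y = f2"
    "y \<cdot> x = Ide C (Dom C t1)" "x \<cdot> y = Ide C (Dom C t2)"
proof -
  note P = pullbackD[OF assms(1)] and Q = pullbackD[OF assms(2)]
  obtain x where x: "x \<in> Arr C" "Dom C x = Dom C t1" "Cod C x = Dom C t2" "t2 \<cdot> x = t1" "f2 \<cdot> x = f1"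
    by (rule pullback_lift[OF assms(2), of t1 f1 "Dom C t1"]) (use P in auto)
  obtain y where y: "y \<in> Arr C" "Dom C y = Dom C t2" "Cod C y = Dom C t1" "t1 \<cdot> y = t2" "f1 \<cdot> y = f2"
    by (rule pullback_lift[OF assms(1), of t2 f2 "Dom C t2"]) (use Q in auto)
  have "y \<cdot> x = Ide C (Dom C t1)"
    by (rule pullback_uniq[OF assms(1)])
      (use P Q x y Dom_Obj in \<open>auto simp flip: Cmp_assoc_arr\<close>)
  moreover have "x \<cdot> y = Ide C (Dom C t2)"
    by (rule pullback_uniq[OF assms(2)])
      (use P Q x y Dom_Obj in \<open>auto simp flip: Cmp_assoc_arr\<close>)
  ultimately show thesis using x y that by blast
qed

section \<open>Vertical isomorphism of spans as an equivalence relation\<close>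

lemma span_iso_parallel:
  assumes "(p, q) \<in> span_iso C S"
  shows "span_dom C p = span_dom C q" "span_cod C p = span_cod C q"
proof -
  obtain x where x: "x \<in> Arr C" "Dom C x = Dom C (fst p)" "Cod C x = Dom C (fst q)"
      "fst q \<cdot> x = fst p" "snd q \<cdot> x = snd p"
    using assms by (auto simp: span_iso_def vertical_def homset_def)
  have q: "fst q \<in> Arr C" "snd q \<in> Arr C" "Dom C (fst q) = Dom C (snd q)"
    using assms by (auto simp: span_iso_def spans_def)
  show "span_dom C p = span_dom C q" "span_cod C p = span_cod C q"
    using Cmp_arr(3)[OF x(1) q(1)] Cmp_arr(3)[OF x(1) q(2)] x(3-5) q(3)
    by (simp_all add: span_dom_def span_cod_def)
qed

lemma span_iso_trans:
  assumes "(p, q) \<in> span_iso C S" "(q, r) \<in> span_iso C S"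
  shows "(p, r) \<in> span_iso C S"
proof -
  have arr: "fst p \<in> Arr C" "snd p \<in> Arr C" "Dom C (snd p) = Dom C (fst p)"
    "fst q \<in> Arr C" "snd q \<in> Arr C" "Dom C (snd q) = Dom C (fst q)"
    "fst r \<in> Arr C" "snd r \<in> Arr C" "Dom C (snd r) = Dom C (fst r)"
    using assms by (auto simp: span_iso_def spans_def)
  obtain x y where x: "x \<in> Arr C" "Dom C x = Dom C (fst p)" "Cod C x = Dom C (fst q)"
      "fst q \<cdot> x = fst p" "snd q \<cdot> x = snd p"
    and y: "y \<in> Arr C" "Dom C y = Dom C (fst q)" "Cod C y = Dom C (fst p)"
      "fst p \<cdot> y = fst q" "snd p \<cdot> y = snd q"
    and xy: "y \<cdot> x = Ide C (Dom C (fst p))" "x \<cdot> y = Ide C (Dom C (fst q))"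
    using assms(1) by (auto simp: span_iso_def vertical_def homset_def)
  obtain x' y' where x': "x' \<in> Arr C" "Dom C x' = Dom C (fst q)" "Cod C x' = Dom C (fst r)"
      "fst r \<cdot> x' = fst q" "snd r \<cdot> x' = snd q"
    and y': "y' \<in> Arr C" "Dom C y' = Dom C (fst r)" "Cod C y' = Dom C (fst q)"
      "fst q \<cdot> y' = fst r" "snd q \<cdot> y' = snd r"
    and xy': "y' \<cdot> x' = Ide C (Dom C (fst q))" "x' \<cdot> y' = Ide C (Dom C (fst r))"
    using assms(2) by (auto simp: span_iso_def vertical_def homset_def)
  have v: "vertical C (x' \<cdot> x) p r" "vertical C (y \<cdot> y') r p"
    using arr x y x' y' by (auto simp: vertical_def homset_def simp flip: Cmp_assoc_arr)
  have "(y \<cdot> y') \<cdot> (x' \<cdot> x) = y \<cdot> ((y' \<cdot> x') \<cdot> x)"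
    using x y x' y' by (simp add: Cmp_assoc_arr)
  also have "\<dots> = Ide C (Dom C (fst p))" using xy xy' x by simp
  finally have i: "(y \<cdot> y') \<cdot> (x' \<cdot> x) = Ide C (Dom C (fst p))" .
  have "(x' \<cdot> x) \<cdot> (y \<cdot> y') = x' \<cdot> ((x \<cdot> y) \<cdot> y')"
    using x y x' y' by (simp add: Cmp_assoc_arr)
  also have "\<dots> = Ide C (Dom C (fst r))" using xy xy' y' by simp
  finally have "(x' \<cdot> x) \<cdot> (y \<cdot> y') = Ide C (Dom C (fst r))" .
  then show ?thesis using v i assms unfolding span_iso_def by blast
qed

lemma equiv_span_iso: "equiv (spans C S) (span_iso C S)"
proof (rule equivI)
  show "span_iso C S \<subseteq> spans C S \<times> spans C S" by (auto simp: span_iso_def)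
  show "refl_on (spans C S) (span_iso C S)"
  proof (rule refl_onI)
    fix p assume p: "p \<in> spans C S"
    then have "vertical C (Ide C (Dom C (fst p))) p p"
      using Dom_Obj by (auto simp: vertical_def homset_def spans_def)
    then show "(p, p) \<in> span_iso C S"
      using p Dom_Obj unfolding span_iso_def by (fastforce simp: spans_def)
  qed
  show "sym (span_iso C S)" by (rule symI) (auto simp: span_iso_def)
  show "trans (span_iso C S)" by (rule transI) (rule span_iso_trans)
qed

section \<open>The quotient of a category by equality\<close>

lemma Id_on_quotient [simp]:
  "Arr C // Id_on (Arr C) = (\<lambda>f. {f}) ` Arr C"
  by (auto simp: quotient_def)

lemma Id_on_Image_singleton: "f \<in> A \<Longrightarrow> Id_on A `` {f} = {f}"
  by auto

lemma quotient_Id_homset: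
  "X \<in> homset (quotient_cat C (Id_on (Arr C))) A B \<longleftrightarrow> (\<exists>f \<in> homset C A B. X = {f})"
  by (auto simp: homset_def quotient_cat_def)

text \<open>All arrows are singletons, so each law is the law of \<open>C\<close> put in
  braces.\<close>

lemma category_quotient_Id: "category (quotient_cat C (Id_on (Arr C)))" (is "category ?Q")
proof
  \<comment> \<open>Typing matters here: the image of a non-arrow under \<open>Id_on (Arr C)\<close>
    is empty.\<close>
  have Cmp: "{g} \<cdot>\<^bsub>?Q\<^esub> {f} = {g \<cdot> f}" if "f \<in> homset C A B" "g \<in> homset C B D" for f g A B D
    using Cmp_homset[OF that] by (auto simp: quotient_cat_def homset_def)
  have Ide: "Ide ?Q A = {Ide C A}" if "A \<in> Obj C" for A
    using that by (auto simp: quotient_cat_def)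
  fix X Y Z A B D E
  show "Dom ?Q X \<in> Obj ?Q" "Cod ?Q X \<in> Obj ?Q" if "X \<in> Arr ?Q"
    using that Dom_Obj Cod_Obj by (auto simp: quotient_cat_def)
  show "Ide ?Q A \<in> homset ?Q A A" if "A \<in> Obj ?Q"
  proof -
    have "A \<in> Obj C" using that by (simp add: quotient_cat_def)
    then show ?thesis using Ide_homset by (auto simp: Ide quotient_Id_homset)
  qed
  show "Y \<cdot>\<^bsub>?Q\<^esub> X \<in> homset ?Q A D" if "X \<in> homset ?Q A B" "Y \<in> homset ?Q B D"
    using that Cmp Cmp_homset by (fastforce simp: quotient_Id_homset)
  show "X \<cdot>\<^bsub>?Q\<^esub> Ide ?Q A = X" "Ide ?Q B \<cdot>\<^bsub>?Q\<^esub> X = X" if X: "X \<in> homset ?Q A B"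
  proof -
    obtain f where f: "f \<in> homset C A B" "X = {f}" using X by (auto simp: quotient_Id_homset)
    have "A \<in> Obj C" "B \<in> Obj C" using f Dom_Obj Cod_Obj by (auto simp: homset_def)
    then show "X \<cdot>\<^bsub>?Q\<^esub> Ide ?Q A = X" "Ide ?Q B \<cdot>\<^bsub>?Q\<^esub> X = X"
      using Cmp[OF Ide_homset f(1)] Cmp[OF f(1) Ide_homset] Cmp_Ide[OF f(1)] Ide_Cmp[OF f(1)]
      by (simp_all add: Ide f(2))
  qed
  show "(Z \<cdot>\<^bsub>?Q\<^esub> Y) \<cdot>\<^bsub>?Q\<^esub> X = Z \<cdot>\<^bsub>?Q\<^esub> (Y \<cdot>\<^bsub>?Q\<^esub> X)"
    if XYZ: "X \<in> homset ?Q A B" "Y \<in> homset ?Q B D" "Z \<in> homset ?Q D E"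
  proof -
    obtain f g h where f: "f \<in> homset C A B" "X = {f}" and g: "g \<in> homset C B D" "Y = {g}"
      and h: "h \<in> homset C D E" "Z = {h}"
      using XYZ unfolding quotient_Id_homset by blast
    show ?thesis
      using f(2) g(2) h(2) Cmp[OF f(1) g(1)] Cmp[OF g(1) h(1)] Cmp[OF f(1) Cmp_homset[OF g(1) h(1)]]
        Cmp[OF Cmp_homset[OF f(1) g(1)] h(1)] Cmp_assoc[OF f(1) g(1) h(1)] by simp
  qed
qed

text \<open>The projection wraps an arrow in a singleton and \<open>the_elem\<close> unwraps it. The
  category is arbitrary here; the lemma is later applied with \<open>Span C S\<close> in its
  place.\<close>

lemma iso_functor_quotient_Id:
  "iso_functor C (quotient_cat C (Id_on (Arr C))) (\<lambda>A. A) (\<lambda>f. Id_on (Arr C) `` {f})"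
    (is "iso_functor C ?Q _ ?F")
proof -
  interpret Q: category ?Q by (rule category_quotient_Id)
  have F: "?F f = {f}" if "f \<in> homset C A B" for f A B
    using that by (auto simp: homset_def)
  have Cmp: "{g} \<cdot>\<^bsub>?Q\<^esub> {f} = {g \<cdot> f}" if "f \<in> homset C A B" "g \<in> homset C B D" for f g A B D
    using Cmp_homset[OF that] by (auto simp: quotient_cat_def homset_def)
  have fwd: "cat_functor C ?Q (\<lambda>A. A) ?F"
  proof
    fix f g A B D
    show "A \<in> Obj ?Q" if "A \<in> Obj C" using that by (simp add: quotient_cat_def)
    show "?F f \<in> homset ?Q A B" if "f \<in> homset C A B"
      unfolding F[OF that] quotient_Id_homset using that by blast
    show "?F (Ide C A) = Ide ?Q A" if "A \<in> Obj C"
      by (simp add: quotient_cat_def)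
    show "?F (g \<cdot> f) = ?F g \<cdot>\<^bsub>?Q\<^esub> ?F f" if "f \<in> homset C A B" "g \<in> homset C B D"
      using F[OF that(1)] F[OF that(2)] F[OF Cmp_homset[OF that]] Cmp[OF that] by simp
  qed
  have bwd: "cat_functor ?Q C (\<lambda>A. A) the_elem"
  proof
    fix X Y A B D
    show "A \<in> Obj C" if "A \<in> Obj ?Q" using that by (simp add: quotient_cat_def)
    show "the_elem X \<in> homset C A B" if "X \<in> homset ?Q A B"
      using that by (auto simp: quotient_Id_homset)
    show "the_elem (Ide ?Q A) = Ide C A" if "A \<in> Obj ?Q"
      using that F[OF Ide_homset, of A] by (simp add: quotient_cat_def)
    show "the_elem (Y \<cdot>\<^bsub>?Q\<^esub> X) = the_elem Y \<cdot> the_elem X"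
      if "X \<in> homset ?Q A B" "Y \<in> homset ?Q B D"
      using that Cmp by (auto simp: quotient_Id_homset)
  qed
  have "\<forall>f\<in>Arr C. the_elem (?F f) = f" "\<forall>X\<in>Arr ?Q. ?F (the_elem X) = X"
    by (auto simp: quotient_cat_def Id_on_Image_singleton)
  with fwd bwd show ?thesis unfolding iso_functor_def by blast
qed

end

section \<open>Horizontal composition up to vertical isomorphism\<close>

context stable_class
begin

lemma Ide_S: "A \<in> Obj C \<Longrightarrow> Ide C A \<in> S"
  using iso_in_S Ide_is_iso by blast

lemma pullback_span: "s \<in> S \<Longrightarrow> is_pullback C f s s' f' \<Longrightarrow> (s', f') \<in> spans C S"
  using pullbackD[of f s s' f'] pullback_in_S[of s f s' f'] by (simp add: spans_def)

lemma pullback_span_Cmp: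
  assumes "(s, f) \<in> spans C S" "(t, g) \<in> spans C S" "is_pullback C f t t' f'"
  shows "(s \<cdot> t', g \<cdot> f') \<in> spans C S"
  using assms pullbackD[OF assms(3)] pullback_in_S[OF _ assms(3)]
  by (auto simp: spans_def intro!: S_Cmp)

text \<open>The comparison arrows between two choices of pullback remain vertical after composition
  with the outer legs \<open>s\<close> and \<open>g\<close>.\<close>

lemma pullback_span_iso:
  assumes "(s, f) \<in> spans C S" "(t, g) \<in> spans C S"
    and "is_pullback C f t t1 f1" "is_pullback C f t t2 f2"
  shows "((s \<cdot> t1, g \<cdot> f1), (s \<cdot> t2, g \<cdot> f2)) \<in> span_iso C S"
proof -
  note P = pullbackD[OF assms(3)] and Q = pullbackD[OF assms(4)]
  have arr: "s \<in> Arr C" "Dom C s = Dom C f" "g \<in> Arr C" "Dom C g = Dom C t"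
    using assms by (auto simp: spans_def)
  obtain x y where xy: "x \<in> Arr C" "Dom C x = Dom C t1" "Cod C x = Dom C t2"
    "y \<in> Arr C" "Dom C y = Dom C t2" "Cod C y = Dom C t1"
    "t2 \<cdot> x = t1" "f2 \<cdot> x = f1" "t1 \<cdot> y = t2" "f1 \<cdot> y = f2"
    "y \<cdot> x = Ide C (Dom C t1)" "x \<cdot> y = Ide C (Dom C t2)"
    by (rule pullback_iso[OF assms(3,4)])
  have "vertical C x (s \<cdot> t1, g \<cdot> f1) (s \<cdot> t2, g \<cdot> f2)"
    "vertical C y (s \<cdot> t2, g \<cdot> f2) (s \<cdot> t1, g \<cdot> f1)"
    using P Q arr xy by (auto simp: vertical_def homset_def Cmp_assoc_arr)
  moreover have "y \<cdot> x = Ide C (Dom C (s \<cdot> t1))" "x \<cdot> y = Ide C (Dom C (s \<cdot> t2))"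
    using P Q arr xy by auto
  ultimately show ?thesis
    using pullback_span_Cmp assms unfolding span_iso_def by auto
qed

text \<open>Since \<open>f = g \<cdot> x\<close>, the pullback behind \<open>h\<close> becomes, via
  \<open>x\<close>, a pullback of \<open>w\<close> along \<open>g\<close>. The composite formed with
  it is \<open>h\<close> itself, as \<open>t \<cdot> x = s\<close>, so \<open>h\<close> and
  \<open>k\<close> differ only by the choice of pullback.\<close>

lemma span_comp_left_iso:
  assumes "(p, q) \<in> span_iso C S" "span_comp C S r p h" "span_comp C S r q k"
  shows "(h, k) \<in> span_iso C S"
proof -
  obtain s f where p: "p = (s, f)" by (cases p)
  obtain t g where q: "q = (t, g)" by (cases q)
  obtain w l where r: "r = (w, l)" by (cases r)
  obtain w1 f1 where pb1: "is_pullback C f w w1 f1" "h = (s \<cdot> w1, l \<cdot> f1)"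
    using assms(2) by (auto simp: span_comp_def p r)
  obtain w2 f2 where pb2: "is_pullback C g w w2 f2" "k = (t \<cdot> w2, l \<cdot> f2)"
    using assms(3) by (auto simp: span_comp_def q r)
  have sp: "(s, f) \<in> spans C S" "(t, g) \<in> spans C S" "(w, l) \<in> spans C S"
    using assms by (auto simp: span_comp_def p q r)
  obtain x y where x: "x \<in> Arr C" "Dom C x = Dom C s" "Cod C x = Dom C t" "t \<cdot> x = s" "g \<cdot> x = f"
    and y: "y \<in> Arr C" "Dom C y = Dom C t" "Cod C y = Dom C s"
    and xy: "y \<cdot> x = Ide C (Dom C s)" "x \<cdot> y = Ide C (Dom C t)"
    using assms(1) by (auto simp: span_iso_def vertical_def homset_def p q)
  have arr: "s \<in> Arr C" "t \<in> Arr C" "g \<in> Arr C" "Dom C t = Dom C g" "Dom C s = Dom C f"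
    using sp by (auto simp: spans_def)
  have "is_pullback C g w (x \<cdot> w1) f1"
    by (rule pullback_iso_leg[where y = y]) (use pb1 x y xy arr in auto)
  from pullback_span_iso[OF sp(2,3) this pb2(1)]
  have "((t \<cdot> (x \<cdot> w1), l \<cdot> f1), k) \<in> span_iso C S" by (simp add: pb2)
  moreover have "t \<cdot> (x \<cdot> w1) = s \<cdot> w1"
    using pullbackD[OF pb1(1)] x arr by (simp flip: Cmp_assoc_arr)
  ultimately show ?thesis by (simp add: pb1)
qed

text \<open>Now the isomorphism acts on the \<open>S\<close>-leg \<open>s = t \<cdot> x\<close>, the
  other side of the square: the square is flipped, changed along \<open>x\<close>, and flipped back.
  The composite formed with it is again \<open>h\<close>, as \<open>g \<cdot> x = f\<close>.\<close>

lemma span_comp_right_iso: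
  assumes "(p, q) \<in> span_iso C S" "span_comp C S p r h" "span_comp C S q r k"
  shows "(h, k) \<in> span_iso C S"
proof -
  obtain s f where p: "p = (s, f)" by (cases p)
  obtain t g where q: "q = (t, g)" by (cases q)
  obtain w l where r: "r = (w, l)" by (cases r)
  obtain s1 l1 where pb1: "is_pullback C l s s1 l1" "h = (w \<cdot> s1, f \<cdot> l1)"
    using assms(2) by (auto simp: span_comp_def p r)
  obtain t2 l2 where pb2: "is_pullback C l t t2 l2" "k = (w \<cdot> t2, g \<cdot> l2)"
    using assms(3) by (auto simp: span_comp_def q r)
  have sp: "(s, f) \<in> spans C S" "(t, g) \<in> spans C S" "(w, l) \<in> spans C S"
    using assms by (auto simp: span_comp_def p q r)
  obtain x y where x: "x \<in> Arr C" "Dom C x = Dom C s" "Cod C x = Dom C t" "t \<cdot> x = s" "g \<cdot> x = f"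
    and y: "y \<in> Arr C" "Dom C y = Dom C t" "Cod C y = Dom C s"
    and xy: "y \<cdot> x = Ide C (Dom C s)" "x \<cdot> y = Ide C (Dom C t)"
    using assms(1) by (auto simp: span_iso_def vertical_def homset_def p q)
  have arr: "s \<in> Arr C" "t \<in> Arr C" "g \<in> Arr C" "Dom C t = Dom C g" "Dom C s = Dom C f"
    using sp by (auto simp: spans_def)
  have "is_pullback C t l (x \<cdot> l1) s1"
    by (rule pullback_iso_leg[where y = y]) (use pullback_sym[OF pb1(1)] x y xy arr in auto)
  from pullback_span_iso[OF sp(3,2) pullback_sym[OF this] pb2(1)]
  have "((w \<cdot> s1, g \<cdot> (x \<cdot> l1)), k) \<in> span_iso C S" by (simp add: pb2)
  moreover have "g \<cdot> (x \<cdot> l1) = f \<cdot> l1"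
    using pullbackD[OF pb1(1)] x arr by (simp flip: Cmp_assoc_arr)
  ultimately show ?thesis by (simp add: pb1)
qed

lemma compatible_span_iso: "compatible C S (span_iso C S)"
proof -
  have spans: "p \<in> spans C S" "q \<in> spans C S" if "(p, q) \<in> span_iso C S" for p q
    using that by (simp_all add: span_iso_def)
  show ?thesis
    unfolding compatible_def
    by (intro conjI ballI case_prodI2 allI impI subset_refl)
      (metis spans span_iso_parallel span_comp_left_iso span_comp_right_iso)+
qed

section \<open>Collapse of the generated relations\<close>

lemma cospan_le_pb_iso:
  assumes mono: "\<forall>s \<in> S. is_mono C s"
    and "cospan_le C S c d" "is_pb C c p" "is_pb C d q"
  shows "(p, q) \<in> span_iso C S"
proof -
  obtain v where v: "v \<in> S" "v \<in> Arr C" "Dom C v = Cod C (fst c)" "v \<cdot> fst c = fst d"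
      "v \<cdot> snd c = snd d"
    using assms(2) by (auto simp: cospan_le_def homset_def)
  have S: "snd c \<in> S" "snd d \<in> S" using assms(2) by (auto simp: cospan_le_def cospans_def)
  \<comment> \<open>Monicity of \<open>v\<close> moves the square of \<open>p\<close> from the
    cospan \<open>c\<close> to \<open>d\<close>, where \<open>q\<close> is a pullback as
    well.\<close>
  have pb1: "is_pullback C (fst d) (snd d) (fst p) (snd p)"
    using pullback_mono[of "fst c" "snd c" "fst p" "snd p" v] assms(1,3) v by (simp add: is_pb_def)
  have pb2: "is_pullback C (fst d) (snd d) (fst q) (snd q)"
    using assms(4) by (simp add: is_pb_def)
  have sp: "p \<in> spans C S" "q \<in> spans C S"
    using pullback_span[OF S(2) pb1] pullback_span[OF S(2) pb2] by auto
  obtain x y where "x \<in> Arr C" "Dom C x = Dom C (fst p)" "Cod C x = Dom C (fst q)"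
    "y \<in> Arr C" "Dom C y = Dom C (fst q)" "Cod C y = Dom C (fst p)"
    "fst q \<cdot> x = fst p" "snd q \<cdot> x = snd p" "fst p \<cdot> y = fst q" "snd p \<cdot> y = snd q"
    "y \<cdot> x = Ide C (Dom C (fst p))" "x \<cdot> y = Ide C (Dom C (fst q))"
    by (rule pullback_iso[OF pb1 pb2])
  then have "vertical C x p q \<and> vertical C y q p \<and>
      y \<cdot> x = Ide C (Dom C (fst p)) \<and> x \<cdot> y = Ide C (Dom C (fst q))"
    by (simp add: vertical_def homset_def)
  then show ?thesis using sp unfolding span_iso_def by blast
qed

text \<open>\<open>span_iso C S\<close> belongs to the family whose intersection is taken, and every
  compatible relation contains it by definition.\<close>

lemma approx_a_eq_span_iso:
  assumes "\<forall>s \<in> S. is_mono C s"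
  shows "approx_a C S = span_iso C S"
proof
  show "approx_a C S \<subseteq> span_iso C S"
    unfolding approx_a_def using compatible_span_iso cospan_le_pb_iso[OF assms] by blast
  show "span_iso C S \<subseteq> approx_a C S"
    by (auto simp: approx_a_def compatible_def)
qed

lemma sim_a_eq_span_iso:
  assumes "\<forall>s \<in> S. is_mono C s"
  shows "sim_a C S = span_iso C S"
  unfolding sim_a_def approx_a_eq_span_iso[OF assms] using equiv_span_iso by blast

text \<open>Related spans now have equal classes, so only diagonal pairs occur; reflexivity supplies
  one for every class. This exhibits \<open>Sect C S\<close> as a quotient by equality.\<close>

lemma sim_a_class_eq_Id_on:
  assumes "\<forall>s \<in> S. is_mono C s"
  shows "sim_a_class C S = Id_on (Arr (Span C S))"
proof -
  have cls: "span_iso C S `` {p} = span_iso C S `` {q}" "p \<in> spans C S" if "(p, q) \<in> span_iso C S" for p q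
    using that equiv_class_eq[OF equiv_span_iso that] by (simp_all add: span_iso_def)
  have refl: "(p, p) \<in> span_iso C S" if "p \<in> spans C S" for p
    using that equiv_class_self[OF equiv_span_iso] by blast
  have "sim_a_class C S = (\<lambda>p. (span_iso C S `` {p}, span_iso C S `` {p})) ` spans C S"
    unfolding sim_a_class_def sim_a_eq_span_iso[OF assms] image_def
    by (intro Collect_cong) (metis cls refl)
  also have "\<dots> = Id_on ((\<lambda>p. span_iso C S `` {p}) ` spans C S)"
    by (auto simp: Id_on_def)
  also have "(\<lambda>p. span_iso C S `` {p}) ` spans C S = Arr (Span C S)"
    by (auto simp: Span_def quotient_def)
  finally show ?thesis .
qed

section \<open>The category of spans\<close>

abbreviation span_class :: "'a \<times> 'a \<Rightarrow> ('a \<times> 'a) set" where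
  "span_class p \<equiv> span_iso C S `` {p}"

lemma span_refl: "p \<in> spans C S \<Longrightarrow> p \<in> span_class p"
  using equiv_class_self[OF equiv_span_iso] .

text \<open>Isomorphic spans are parallel, so \<open>the_elem\<close> is applied to a
  singleton.\<close>

lemma span_class_dom: "p \<in> spans C S \<Longrightarrow> Dom (Span C S) (span_class p) = span_dom C p"
proof -
  assume p: "p \<in> spans C S"
  have "\<forall>q \<in> span_class p. span_dom C q = span_dom C p"
    using span_iso_parallel(1) by (metis Image_singleton_iff)
  then have "span_dom C ` span_class p = {span_dom C p}"
    using span_refl[OF p] by blast
  then show ?thesis by (simp add: Span_def)
qed

lemma span_class_cod: "p \<in> spans C S \<Longrightarrow> Cod (Span C S) (span_class p) = span_cod C p"
proof -
  assume p: "p \<in> spans C S"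
  have "\<forall>q \<in> span_class p. span_cod C q = span_cod C p"
    using span_iso_parallel(2) by (metis Image_singleton_iff)
  then have "span_cod C ` span_class p = {span_cod C p}"
    using span_refl[OF p] by blast
  then show ?thesis by (simp add: Span_def)
qed

text \<open>Provides a representative with known end objects, so that the category laws can be
  checked on spans.\<close>

lemma Span_homset:
  "X \<in> homset (Span C S) A B \<longleftrightarrow>
     (\<exists>p \<in> spans C S. span_dom C p = A \<and> span_cod C p = B \<and> X = span_class p)"
proof -
  have "X \<in> Arr (Span C S) \<longleftrightarrow> (\<exists>p \<in> spans C S. X = span_class p)"
    by (auto simp: Span_def quotient_def)
  then show ?thesis
    using span_class_dom span_class_cod by (fastforce simp: homset_def)
qed

lemma span_comp_exists:
  assumes "p \<in> spans C S" "q \<in> spans C S" "span_cod C p = span_dom C q"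
  obtains h where "span_comp C S q p h"
proof -
  have "snd p \<in> Arr C" "fst q \<in> S" "Cod C (snd p) = Cod C (fst q)"
    using assms by (auto simp: spans_def span_dom_def span_cod_def)
  from pullback_exists[OF this] obtain t' f' where "is_pullback C (snd p) (fst q) t' f'"
    by blast
  then have "span_comp C S q p (fst p \<cdot> t', snd q \<cdot> f')"
    unfolding span_comp_def case_prod_beta using assms by blast
  then show thesis by (rule that)
qed

lemma span_comp_composable: "span_comp C S q p h \<Longrightarrow> span_cod C p = span_dom C q"
  unfolding span_comp_def case_prod_beta span_dom_def span_cod_def by (metis pullbackD(5))

lemma span_comp_span:
  assumes "span_comp C S q p h"
  shows "h \<in> spans C S" "span_dom C h = span_dom C p" "span_cod C h = span_cod C q"
proof -
  obtain s f t g where pq: "p = (s, f)" "q = (t, g)" by (cases p, cases q)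
  then obtain t' f' where pb: "is_pullback C f t t' f'" and h: "h = (s \<cdot> t', g \<cdot> f')"
    and sp: "(s, f) \<in> spans C S" "(t, g) \<in> spans C S"
    using assms by (auto simp: span_comp_def)
  show "h \<in> spans C S" using pullback_span_Cmp[OF sp pb] h by simp
  show "span_dom C h = span_dom C p" "span_cod C h = span_cod C q"
    using pullbackD[OF pb] sp by (auto simp: pq h span_dom_def span_cod_def spans_def)
qed

text \<open>All composites of all representatives are isomorphic, so the union defining the product
  is one class. An equation in \<open>Span C S\<close> is thereby reduced to exhibiting suitable
  composites of spans.\<close>

lemma Span_Cmp:
  assumes "span_comp C S q p h"
  shows "span_class q \<cdot>\<^bsub>Span C S\<^esub> span_class p = span_class h"
proof -
  have sp: "p \<in> spans C S" "q \<in> spans C S" using assms by (auto simp: span_comp_def)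
  have *: "span_class k = span_class h"
    if p': "p' \<in> span_class p" and q': "q' \<in> span_class q" and k: "span_comp C S q' p' k" for p' q' k
  proof -
    have pp: "(p, p') \<in> span_iso C S" and qq: "(q, q') \<in> span_iso C S" using p' q' by auto
    have "p' \<in> spans C S" using pp by (simp add: span_iso_def)
    moreover have "span_cod C p' = span_dom C q"
      using span_iso_parallel(1)[OF qq] span_comp_composable[OF k] by simp
    \<comment> \<open>The composite \<open>m\<close> of \<open>p'\<close> with the old
      \<open>q\<close> lies between \<open>h\<close> and \<open>k\<close>, so that only one factor
      changes at a time.\<close>
    ultimately obtain m where m: "span_comp C S q p' m"
      using span_comp_exists sp by blast
    have "(h, m) \<in> span_iso C S" by (rule span_comp_left_iso[OF pp assms m])
    moreover have "(m, k) \<in> span_iso C S" by (rule span_comp_right_iso[OF qq m k])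
    ultimately show ?thesis
      using equiv_class_eq[OF equiv_span_iso] span_iso_trans by metis
  qed
  have "span_class q \<cdot>\<^bsub>Span C S\<^esub> span_class p =
      (\<Union>q' \<in> span_class q. \<Union>p' \<in> span_class p. \<Union>k \<in> {k. span_comp C S q' p' k}. span_class k)"
    by (auto simp: Span_def)
  also have "\<dots> = span_class h"
    \<comment> \<open>The representatives \<open>p\<close>, \<open>q\<close> and the composite
      \<open>h\<close> show that the union is not empty.\<close>
    using * span_refl[OF sp(1)] span_refl[OF sp(2)] assms by blast
  finally show ?thesis .
qed

lemma Ide_span:
  assumes "A \<in> Obj C"
  shows "(Ide C A, Ide C A) \<in> spans C S"
    "span_dom C (Ide C A, Ide C A) = A" "span_cod C (Ide C A, Ide C A) = A"
  using assms Ide_S by (auto simp: spans_def span_dom_def span_cod_def)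

text \<open>With \<open>s\<close> itself taken as the pullback of \<open>s\<close> along an
  identity, the composite is exactly \<open>p\<close>, not just isomorphic to it.\<close>

lemma span_comp_Ide_right:
  assumes "p \<in> spans C S"
  shows "span_comp C S p (Ide C (span_dom C p), Ide C (span_dom C p)) p"
proof -
  obtain s f where p: "p = (s, f)" by (cases p)
  have s: "s \<in> Arr C" "f \<in> Arr C" "Dom C f = Dom C s" using assms by (auto simp: p spans_def)
  have "is_pullback C (Ide C (Cod C s)) s s (Ide C (Dom C s))"
    using pullback_sym[OF pullback_Ide] s by simp
  then show ?thesis
    unfolding span_comp_def p span_dom_def fst_conv prod.case
    by (intro conjI exI[of _ s] exI[of _ "Ide C (Dom C s)"])
      (use assms Ide_span(1)[OF Cod_Obj[OF s(1)]] s p in simp_all)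
qed

lemma span_comp_Ide_left:
  assumes "p \<in> spans C S"
  shows "span_comp C S (Ide C (span_cod C p), Ide C (span_cod C p)) p p"
proof -
  obtain s f where p: "p = (s, f)" by (cases p)
  have s: "s \<in> Arr C" "f \<in> Arr C" "Dom C f = Dom C s" using assms by (auto simp: p spans_def)
  have "is_pullback C f (Ide C (Cod C f)) (Ide C (Dom C s)) f"
    using pullback_Ide[of f] s by simp
  then show ?thesis
    unfolding span_comp_def p span_cod_def snd_conv prod.case
    by (intro conjI exI[of _ "Ide C (Dom C s)"] exI[of _ f])
      (use assms Ide_span(1)[OF Cod_Obj[OF s(2)]] s p in simp_all)
qed

text \<open>Two pullbacks serve \<open>h\<close> and \<open>k\<close>; a third, over
  \<open>f'\<close> and \<open>w'\<close>, completes the diagram. Pasting it onto either of the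
  first two yields a pullback for each bracketing, and both composites are the same span
  \<open>m\<close>.\<close>

lemma span_comp_assoc:
  assumes "p \<in> spans C S" "q \<in> spans C S" "r \<in> spans C S"
    and "span_cod C p = span_dom C q" "span_cod C q = span_dom C r"
  obtains h k m where "span_comp C S q p h" "span_comp C S r q k"
    "span_comp C S r h m" "span_comp C S k p m"
proof -
  obtain s f where p: "p = (s, f)" by (cases p)
  obtain t g where q: "q = (t, g)" by (cases q)
  obtain w l where r: "r = (w, l)" by (cases r)
  have arr: "s \<in> Arr C" "f \<in> Arr C" "Dom C s = Dom C f" "t \<in> Arr C" "g \<in> Arr C"
    "Dom C g = Dom C t" "w \<in> Arr C" "l \<in> Arr C" "Dom C l = Dom C w"
    "s \<in> S" "t \<in> S" "w \<in> S" "Cod C f = Cod C t" "Cod C g = Cod C w"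
    using assms by (auto simp: p q r spans_def span_dom_def span_cod_def)
  obtain t' f' where pb1: "is_pullback C f t t' f'" using pullback_exists arr by blast
  obtain w' g' where pb2: "is_pullback C g w w' g'" using pullback_exists arr by blast
  note P = pullbackD[OF pb1] and Q = pullbackD[OF pb2]
  \<comment> \<open>Stability of \<open>S\<close> under pullback is what guarantees the third
    square.\<close>
  have "w' \<in> S" using pullback_in_S arr pb2 by blast
  then obtain w'' f'' where pb3: "is_pullback C f' w' w'' f''"
    using pullback_exists[of f' w'] P Q arr by auto
  note R = pullbackD[OF pb3]
  have [simp]: "Cod C w' = Dom C t" using Q arr by simp
  have pbl: "is_pullback C f (t \<cdot> w') (t' \<cdot> w'') f''"
    by (rule pullback_paste[OF pb1 pb3])
  \<comment> \<open>Pasting in the other direction: both squares are flipped first, and the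
    resulting rectangle is flipped back.\<close>
  have pbr: "is_pullback C (g \<cdot> f') w w'' (g' \<cdot> f'')"
    by (rule pullback_sym[OF pullback_paste[OF pullback_sym[OF pb2] pullback_sym[OF pb3]]])
  have h: "span_comp C S q p (s \<cdot> t', g \<cdot> f')" and k: "span_comp C S r q (t \<cdot> w', l \<cdot> g')"
    using pb1 pb2 assms by (auto simp: span_comp_def p q r)
  have "span_comp C S r (s \<cdot> t', g \<cdot> f') ((s \<cdot> t') \<cdot> w'', l \<cdot> (g' \<cdot> f''))"
    using pbr span_comp_span(1)[OF h] assms by (auto simp: span_comp_def r)
  moreover have "span_comp C S (t \<cdot> w', l \<cdot> g') p (s \<cdot> (t' \<cdot> w''), (l \<cdot> g') \<cdot> f'')"
    using pbl span_comp_span(1)[OF k] assms by (auto simp: span_comp_def p)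
  moreover have "(s \<cdot> t') \<cdot> w'' = s \<cdot> (t' \<cdot> w'')"
    by (rule Cmp_assoc_arr) (use P R arr in simp_all)
  moreover have "(l \<cdot> g') \<cdot> f'' = l \<cdot> (g' \<cdot> f'')"
    by (rule Cmp_assoc_arr) (use Q R arr in simp_all)
  ultimately show thesis using h k that by simp
qed

lemma category_Span: "category (Span C S)"
proof
  fix X Y Z A B D E
  have Obj: "Obj (Span C S) = Obj C" by (simp add: Span_def)
  have dom_cod: "span_dom C p \<in> Obj C" "span_cod C p \<in> Obj C" if "p \<in> spans C S" for p
    using that Cod_Obj by (auto simp: spans_def span_dom_def span_cod_def)
  have Ide: "Ide (Span C S) A = span_class (Ide C A, Ide C A)" for A
    by (simp add: Span_def)
  show "Dom (Span C S) X \<in> Obj (Span C S)" "Cod (Span C S) X \<in> Obj (Span C S)"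
    if X: "X \<in> Arr (Span C S)"
  proof -
    obtain p where "p \<in> spans C S" "X = span_class p"
      using X by (auto simp: Span_def quotient_def)
    then show "Dom (Span C S) X \<in> Obj (Span C S)" "Cod (Span C S) X \<in> Obj (Span C S)"
      using dom_cod by (auto simp: Obj span_class_dom span_class_cod)
  qed
  show "Ide (Span C S) A \<in> homset (Span C S) A A" if "A \<in> Obj (Span C S)"
    using that Ide_span unfolding Span_homset Ide Obj by blast
  show "Y \<cdot>\<^bsub>Span C S\<^esub> X \<in> homset (Span C S) A D"
    if XY: "X \<in> homset (Span C S) A B" "Y \<in> homset (Span C S) B D"
  proof -
    obtain p q where p: "p \<in> spans C S" "span_dom C p = A" "span_cod C p = B" "X = span_class p"
      and q: "q \<in> spans C S" "span_dom C q = B" "span_cod C q = D" "Y = span_class q"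
      using XY unfolding Span_homset by blast
    obtain h where h: "span_comp C S q p h" using span_comp_exists p q by metis
    show ?thesis using span_comp_span[OF h] Span_Cmp[OF h] p q unfolding Span_homset by auto
  qed
  show "X \<cdot>\<^bsub>Span C S\<^esub> Ide (Span C S) A = X" "Ide (Span C S) B \<cdot>\<^bsub>Span C S\<^esub> X = X"
    if "X \<in> homset (Span C S) A B"
    using that Span_Cmp[OF span_comp_Ide_right] Span_Cmp[OF span_comp_Ide_left]
    unfolding Span_homset Ide by auto
  show "(Z \<cdot>\<^bsub>Span C S\<^esub> Y) \<cdot>\<^bsub>Span C S\<^esub> X = Z \<cdot>\<^bsub>Span C S\<^esub> (Y \<cdot>\<^bsub>Span C S\<^esub> X)"
    if XYZ: "X \<in> homset (Span C S) A B" "Y \<in> homset (Span C S) B D" "Z \<in> homset (Span C S) D E"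
  proof -
    obtain p q r where p: "p \<in> spans C S" "span_cod C p = B" "X = span_class p"
      and q: "q \<in> spans C S" "span_dom C q = B" "span_cod C q = D" "Y = span_class q"
      and r: "r \<in> spans C S" "span_dom C r = D" "Z = span_class r"
      using XYZ unfolding Span_homset by blast
    obtain h k m where "span_comp C S q p h" "span_comp C S r q k"
      "span_comp C S r h m" "span_comp C S k p m"
      by (rule span_comp_assoc[of p q r]) (use p q r in auto)
    then show ?thesis unfolding p(3) q(4) r(3) by (simp only: Span_Cmp)
  qed
qed

end

text \<open>The inverse functor serves as witness. The direction is reversed because the projection
  runs from \<open>Span C S\<close> to \<open>Sect C S\<close>, while the isomorphism of categories
  is asserted the other way round.\<close>

lemma iso_functor_isomorphic_cats:
  assumes "iso_functor C D Fo Fa"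
  shows "isomorphic_cats D C"
  using assms unfolding isomorphic_cats_def iso_functor_def by blast

theorem corollary2:
  fixes C :: "('o, 'a) cat" and S :: "'a set"
  assumes "stable_class C S"
    and "\<forall>s \<in> S. is_mono C s"
  shows "(\<forall>s f t g. (s, f) \<in> spans C S \<and> (t, g) \<in> spans C S \<longrightarrow>
            (((s, f), (t, g)) \<in> sim_a C S \<longleftrightarrow> ((s, f), (t, g)) \<in> span_iso C S))
       \<and> iso_functor (Span C S) (Sect C S) (\<lambda>A. A) (\<lambda>X. sim_a_class C S `` {X})
       \<and> isomorphic_cats (Sect C S) (partial_map_cat C S)"
proof -
  interpret stable_class C S by (rule assms(1))
  have iso: "iso_functor (Span C S) (Sect C S) (\<lambda>A. A) (\<lambda>X. sim_a_class C S `` {X})"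
    \<comment> \<open>The congruence is replaced by equality both in the target category and in the
      arrow map.\<close>
    unfolding Sect_def sim_a_class_eq_Id_on[OF assms(2)]
    by (rule category.iso_functor_quotient_Id[OF category_Span])
  show ?thesis
    using iso iso_functor_isomorphic_cats[OF iso] by (simp add: sim_a_eq_span_iso[OF assms(2)])
qed

end
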